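(* Let $G$ be a finite, simple, connected graph which is not an extended star graph, and let $\chi=\chi(G)$ be its (proper) vertex chromatic number. Then: (a) $\chi^o(G)$ is even if and only if $\chi=2$; (b) if $\chi^o(G)>1$ is odd, then $\chi=3$.
   Context: All graphs are finite, simple and connected. An extended star graph is a tree with exactly one vertex of degree $\geq3$. An oriented edge $[v,w]$ is an edge $\{v,w\}$ with input $v$ and output $w$; $\mathcal{O}=\{[v,w],[w,v]: v\sim w\}$. For $k\geq 1$, $G$ is circularly $k$-partite if $\mathcal{O}$ can be partitioned as $\mathcal{O}=\mathcal{O}_1\sqcup\cdots\sqcup\mathcal{O}_k$ with all $\mathcal{O}_j$ non-empty and such that $[v,w]\in\mathcal{O}_j$ implies $[w,z]\in\mathcal{O}_{j+1}$ for every $z\sim w$ with $z\neq v$, indices modulo $k$. The oriented edge periodic colouring number $\chi^o(G)$ is the largest $k$ such that $G$ is circularly $k$-partite. *)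

theory Defs
  imports "Graph_Theory.Graph_Theory" "HOL-Library.Disjoint_Sets"
begin

text \<open>
  A finite simple graph is a \<^locale>\<open>pair_graph\<close>: a finite vertex set together with a finite,
  symmetric, irreflexive set of arcs.  Each edge \<open>{v, w}\<close> is present as the two arcs
  \<open>(v, w)\<close> and \<open>(w, v)\<close>, so \<open>parcs G\<close> is exactly the set of oriented edges.
\<close>

text \<open>
  The library's \<open>tree\<close> is unsuitable for symmetric digraphs, because there the closed walk
  \<open>v, w, v\<close> along a single edge already counts as a \<open>cycle\<close>.  The cycles of the
  undirected graph are those of length at least 3.
\<close>

definition undirected_tree :: "'a pair_pre_digraph \<Rightarrow> bool" where
  "undirected_tree G \<longleftrightarrow> Digraph_Component.connected (with_proj G) \<and>
     \<not> (\<exists>p. pre_digraph.cycle (with_proj G) p \<and> 3 \<le> length p)"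

text \<open>In a symmetric digraph the undirected degree is the out-degree.\<close>

definition extended_star :: "'a pair_pre_digraph \<Rightarrow> bool" where
  "extended_star G \<longleftrightarrow> undirected_tree G \<and>
     (\<exists>!v. v \<in> pverts G \<and> 3 \<le> out_degree (with_proj G) v)"

definition proper_colouring :: "'a pair_pre_digraph \<Rightarrow> nat \<Rightarrow> ('a \<Rightarrow> nat) \<Rightarrow> bool" where
  "proper_colouring G n c \<longleftrightarrow>
     (\<forall>v \<in> pverts G. c v < n) \<and> (\<forall>v w. (v, w) \<in> parcs G \<longrightarrow> c v \<noteq> c w)"

definition chromatic_number :: "'a pair_pre_digraph \<Rightarrow> nat" where
  "chromatic_number G = (LEAST n. \<exists>c. proper_colouring G n c)"

text \<open>The classes are indexed by \<open>0, \<dots>, k - 1\<close> instead of \<open>1, \<dots>, k\<close>.\<close>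

definition circularly_partite :: "'a pair_pre_digraph \<Rightarrow> nat \<Rightarrow> bool" where
  "circularly_partite G k \<longleftrightarrow> 1 \<le> k \<and>
     (\<exists>P :: nat \<Rightarrow> ('a \<times> 'a) set.
        (\<Union>j<k. P j) = parcs G \<and>
        disjoint_family_on P {..<k} \<and>
        (\<forall>j<k. P j \<noteq> {}) \<and>
        (\<forall>j<k. \<forall>v w z. (v, w) \<in> P j \<and> (w, z) \<in> parcs G \<and> z \<noteq> v
            \<longrightarrow> (w, z) \<in> P ((j + 1) mod k)))"

text \<open>
  A graph with an edge is circularly 1-partite, and its number of oriented edges bounds every
  possible \<open>k\<close>, so the largest \<open>k\<close> exists.  For the edgeless one-vertex graph no \<open>k\<close> is
  possible and the notion is undefined; the total function takes the value 1 there.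
\<close>

definition oriented_edge_periodic_colouring_number :: "'a pair_pre_digraph \<Rightarrow> nat" where
  "oriented_edge_periodic_colouring_number G =
     (if \<exists>k. circularly_partite G k then GREATEST k. circularly_partite G k else 1)"

lemma circularly_partite_one_iff: "circularly_partite G 1 \<longleftrightarrow> parcs G \<noteq> {}"
proof
  assume "circularly_partite G 1"
  then show "parcs G \<noteq> {}" by (auto simp: circularly_partite_def)
next
  assume "parcs G \<noteq> {}"
  then show "circularly_partite G 1"
    unfolding circularly_partite_def
    by (intro conjI exI[of _ "\<lambda>_. parcs G"]) (auto simp: disjoint_family_on_def)
qed

lemma circularly_partite_le_card:
  assumes "finite (parcs G)" "circularly_partite G k"
  shows "k \<le> card (parcs G)"
proof -
  obtain P where P: "(\<Union>j<k. P j) = parcs G" "disjoint_family_on P {..<k}" "\<forall>j<k. P j \<noteq> {}"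
    using assms(2) unfolding circularly_partite_def by blast
  define f where "f j = (SOME e. e \<in> P j)" for j
  have f: "f j \<in> P j" if "j < k" for j
    using P(3) that unfolding f_def by (metis some_in_eq)
  have "inj_on f {..<k}"
  proof (rule inj_onI)
    fix i j assume ij: "i \<in> {..<k}" "j \<in> {..<k}" "f i = f j"
    then have "f i \<in> P i \<inter> P j"
      using f[of i] f[of j] by simp
    then show "i = j"
      using P(2) ij(1,2) unfolding disjoint_family_on_def by blast
  qed
  moreover have "f ` {..<k} \<subseteq> parcs G"
    using f P(1) by blast
  ultimately show ?thesis
    using card_inj_on_le[of f "{..<k}" "parcs G"] assms(1) by simp
qed

lemma oriented_edge_periodic_colouring_number_greatest:
  assumes "finite (parcs G)" "parcs G \<noteq> {}"
  shows "circularly_partite G (oriented_edge_periodic_colouring_number G)"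
    and "circularly_partite G k \<Longrightarrow> k \<le> oriented_edge_periodic_colouring_number G"
proof -
  have ex: "circularly_partite G 1"
    using assms(2) circularly_partite_one_iff by blast
  have bd: "\<And>k. circularly_partite G k \<Longrightarrow> k \<le> card (parcs G)"
    using circularly_partite_le_card assms(1) by blast
  have eq: "oriented_edge_periodic_colouring_number G = (GREATEST k. circularly_partite G k)"
    using ex unfolding oriented_edge_periodic_colouring_number_def by auto
  show "circularly_partite G (oriented_edge_periodic_colouring_number G)"
    unfolding eq using GreatestI_nat[of "circularly_partite G" 1] ex bd by blast
  show "circularly_partite G k \<Longrightarrow> k \<le> oriented_edge_periodic_colouring_number G"
    unfolding eq using Greatest_le_nat[of "circularly_partite G" k] bd by blast
qed

end

theory Submission
  imports Defs
begin

text \<open>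
  A circular partition with \<open>k\<close> classes is a labelling of the arcs by residues modulo \<open>k\<close> that
  increases by 1 along every non-backtracking step.

  If \<open>k\<close> is even, labels alternate in parity along a shortest odd closed walk, which does not
  backtrack; this is impossible, so \<open>G\<close> is bipartite.

  The sum of the labels of the two arcs of an edge is constant modulo \<open>k\<close>.  If \<open>k > 1\<close> is odd, the
  labels can be shifted so that this sum is 1.  Then the labels of all arcs into a vertex agree up to
  sign, and their absolute value \<open>g\<close> maps \<open>G\<close> homomorphically to a path with a loop at one end.
  The edges lying over the loop form a matching.  Colouring by the parity of \<open>g\<close> and giving a third
  colour to one end of every matching edge is proper.

  If \<open>G\<close> is bipartite, an odd \<open>k\<close> is never maximal.  The Chinese remainder theorem combines
  the labelling with the bipartition to a labelling modulo \<open>2 k\<close>.  It is onto as soon as one can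
  walk forever, where turning around is allowed at vertices of degree at least 3: there the
  out-labels exceed all in-labels by 1.  One can walk forever on a cycle or between two vertices of
  degree at least 3.  In the remaining case \<open>G\<close> is a path, because it is not an extended star, and
  walking there and back gives all arcs, an even number, different labels.
\<close>

section \<open>Circular partitions as arc labellings\<close>

text \<open>Surjectivity, the counterpart of non-empty classes, is left out so that a labelling can
  be built first and shown to be onto afterwards.\<close>

definition arc_labelling :: "'a rel \<Rightarrow> nat \<Rightarrow> ('a \<times> 'a \<Rightarrow> nat) \<Rightarrow> bool" where
  "arc_labelling A k d \<longleftrightarrow> (\<forall>a\<in>A. d a < k) \<and>
     (\<forall>v w z. (v, w) \<in> A \<longrightarrow> (w, z) \<in> A \<longrightarrow> z \<noteq> v \<longrightarrow> d (w, z) = (d (v, w) + 1) mod k)"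

definition bipartition :: "'a rel \<Rightarrow> ('a \<Rightarrow> bool) \<Rightarrow> bool" where
  "bipartition A b \<longleftrightarrow> (\<forall>v w. (v, w) \<in> A \<longrightarrow> b v \<noteq> b w)"

text \<open>A local form of an endless walk: every arc of \<open>S\<close> can be continued within
  \<open>S\<close>, so no infinite sequence has to be built.\<close>

definition perpetual :: "'a rel \<Rightarrow> 'a rel \<Rightarrow> bool" where
  "perpetual A S \<longleftrightarrow> S \<noteq> {} \<and> S \<subseteq> A \<and>
     (\<forall>u v. (u, v) \<in> S \<longrightarrow> (\<exists>z. (v, z) \<in> S \<and> (z \<noteq> u \<or> 3 \<le> card (A `` {v}))))"

lemma arc_labelling_less: "arc_labelling A k d \<Longrightarrow> a \<in> A \<Longrightarrow> d a < k"
  by (simp add: arc_labelling_def)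

lemma arc_labelling_step:
  "arc_labelling A k d \<Longrightarrow> (v, w) \<in> A \<Longrightarrow> (w, z) \<in> A \<Longrightarrow> z \<noteq> v \<Longrightarrow> d (w, z) = (d (v, w) + 1) mod k"
  by (simp add: arc_labelling_def)

lemma circularly_partite_iff_labelling:
  "circularly_partite G k \<longleftrightarrow>
     1 \<le> k \<and> (\<exists>d. arc_labelling (parcs G) k d \<and> d ` parcs G = {..<k})"
proof
  assume "circularly_partite G k"
  then obtain P where k: "1 \<le> k" and P: "(\<Union>j<k. P j) = parcs G" "disjoint_family_on P {..<k}"
      "\<forall>j<k. P j \<noteq> {}"
    and step: "\<forall>j<k. \<forall>v w z. (v, w) \<in> P j \<and> (w, z) \<in> parcs G \<and> z \<noteq> v
       \<longrightarrow> (w, z) \<in> P ((j + 1) mod k)"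
    unfolding circularly_partite_def by (elim conjE exE)
  define d where "d a = (THE j. j < k \<and> a \<in> P j)" for a
  have d: "d a = j" if "j < k" "a \<in> P j" for a j
    unfolding d_def using that P(2) unfolding disjoint_family_on_def
    by (intro the_equality) auto
  have d': "d a < k \<and> a \<in> P (d a)" if "a \<in> parcs G" for a
    using that P(1) d by fastforce
  have "arc_labelling (parcs G) k d"
    unfolding arc_labelling_def
  proof (intro conjI ballI allI impI)
    fix v w z assume "(v, w) \<in> parcs G" "(w, z) \<in> parcs G" "z \<noteq> v"
    then have "(w, z) \<in> P ((d (v, w) + 1) mod k)" using step d' by blast
    then show "d (w, z) = (d (v, w) + 1) mod k" using k by (intro d) simp_all
  qed (use d' in blast)
  moreover have "d ` parcs G = {..<k}"
  proof (intro equalityI subsetI)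
    fix j assume "j \<in> {..<k}"
    then obtain a where "a \<in> P j" using P(3) by blast
    then show "j \<in> d ` parcs G" using d P(1) \<open>j \<in> {..<k}\<close> by (intro image_eqI[of _ _ a]) auto
  qed (use d' in auto)
  ultimately show "1 \<le> k \<and> (\<exists>d. arc_labelling (parcs G) k d \<and> d ` parcs G = {..<k})"
    using k by blast
next
  assume "1 \<le> k \<and> (\<exists>d. arc_labelling (parcs G) k d \<and> d ` parcs G = {..<k})"
  then obtain d where k: "1 \<le> k" and d: "arc_labelling (parcs G) k d" "d ` parcs G = {..<k}"
    by blast
  let ?P = "\<lambda>j. {a \<in> parcs G. d a = j}"
  have "(\<Union>j<k. ?P j) = parcs G" using d by (auto simp: arc_labelling_def)
  moreover have "disjoint_family_on ?P {..<k}" by (auto simp: disjoint_family_on_def)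
  moreover have "\<forall>j<k. ?P j \<noteq> {}"
  proof (intro allI impI)
    fix j assume "j < k"
    then have "j \<in> d ` parcs G" using d(2) by simp
    then show "?P j \<noteq> {}" by blast
  qed
  moreover have "\<forall>j<k. \<forall>v w z. (v, w) \<in> ?P j \<and> (w, z) \<in> parcs G \<and> z \<noteq> v
       \<longrightarrow> (w, z) \<in> ?P ((j + 1) mod k)"
    using d(1) by (auto simp: arc_labelling_def)
  ultimately show "circularly_partite G k"
    unfolding circularly_partite_def using k by blast
qed

section \<open>Absolute values of residues\<close>

text \<open>For \<open>k > 0\<close> this is the distance from \<open>y\<close> to the nearest
  multiple of \<open>k\<close>.\<close>

definition residue_abs :: "int \<Rightarrow> int \<Rightarrow> int" where
  "residue_abs k y = min (y mod k) ((- y) mod k)"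

lemma residue_abs_minus: "residue_abs k (- y) = residue_abs k y"
  by (simp add: residue_abs_def min.commute)

lemma residue_abs_cong: "y mod k = z mod k \<Longrightarrow> residue_abs k y = residue_abs k z"
  using mod_minus_cong[of y k z] by (simp only: residue_abs_def)

text \<open>As \<open>y\<close> runs through \<open>0, ..., k - 1\<close>, the absolute value runs
  through \<open>0, 1, ..., (k - 1) / 2, (k - 1) / 2, ..., 1\<close>. Cyclic neighbours differ by 1
  except in the middle.\<close>

lemma residue_abs_pred_parity:
  fixes k y :: int
  assumes k: "k > 1" "odd k" and y: "0 \<le> y" "y < k"
    and par: "even (residue_abs k y) \<longleftrightarrow> even (residue_abs k (y - 1))"
  shows "2 * y = k + 1"
proof -
  have k3: "3 \<le> k" using k by presburger
  have neg: "(- x) mod k = (if x = 0 then 0 else k - x)" if "0 \<le> x" "x < k" for x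
    using that by (simp add: zmod_zminus1_eq_if)
  have abs: "residue_abs k x = (if 2 * x < k then x else k - x)" if "0 \<le> x" "x < k" for x
    using that neg[OF that] by (auto simp: residue_abs_def)
  show ?thesis
  proof (cases "y = 0")
    case True
    \<comment> \<open>The predecessor -1 lies outside the range of \<open>abs\<close> and is
      replaced by 1 through the sign symmetry.\<close>
    have "residue_abs k (y - 1) = residue_abs k 1"
      using True residue_abs_minus[of k 1] by simp
    then show ?thesis using par True k3 abs[of 0] abs[of 1] by (auto split: if_splits)
  next
    case False
    then have "even (if 2 * y < k then y else k - y) \<longleftrightarrow> even (if 2 * (y - 1) < k then y - 1 else k - (y - 1))"
      using par y abs[of y] abs[of "y - 1"] by simp
    then show ?thesis using k y by presburger
  qed
qed

section \<open>Closed walks and bipartitions\<close>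

text \<open>With only a relation at hand, the vertices are the ends of arcs; by symmetry
  \<open>Domain A\<close> contains all of them.\<close>

locale symmetric_arcs =
  fixes A :: "'a rel"
  assumes fin: "finite A"
    and sym: "(u, v) \<in> A \<Longrightarrow> (v, u) \<in> A"
    and irrefl: "(u, u) \<notin> A"
    and conn: "u \<in> Domain A \<Longrightarrow> v \<in> Domain A \<Longrightarrow> (u, v) \<in> A\<^sup>*"
begin

lemma finite_nbs: "finite (A `` {v})"
  using fin by (rule finite_Image)

lemma relpow_sym: "(u, v) \<in> A ^^ n \<Longrightarrow> (v, u) \<in> A ^^ n"
proof (induction n arbitrary: v)
  case (Suc n)
  then obtain w where "(u, w) \<in> A ^^ n" "(w, v) \<in> A" by auto
  then show ?case using Suc.IH sym by (meson relpow_Suc_I2)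
qed simp

text \<open>Cutting a backtrack out of an odd closed walk leaves an odd closed walk shorter by 2, so
  a shortest one has none.\<close>

lemma odd_closed_walk_nonbacktracking:
  assumes "(r, r) \<in> A ^^ n" "odd n"
  obtains f m where "odd m" "\<And>i. (f i, f (Suc i)) \<in> A" "\<And>i. f (i + m) = f i"
    "\<And>i. f i \<noteq> f (Suc (Suc i))"
proof -
  define m where "m = (LEAST n. odd n \<and> (\<exists>r. (r, r) \<in> A ^^ n))"
  have "odd m \<and> (\<exists>r. (r, r) \<in> A ^^ m)" unfolding m_def by (rule LeastI) (use assms in blast)
  then obtain r where m: "odd m" "(r, r) \<in> A ^^ m" by blast
  have min: "m \<le> n" if "odd n" "(r, r) \<in> A ^^ n" for n r
    unfolding m_def by (rule Least_le) (use that in blast)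
  have "m \<noteq> 1" using m irrefl by auto
  then have m3: "3 \<le> m" using m(1) by presburger
  obtain g where g: "g 0 = r" "g m = r" "\<And>i. i < m \<Longrightarrow> (g i, g (Suc i)) \<in> A"
    using m(2) unfolding relpow_fun_conv by blast
  \<comment> \<open>The periodic extension covers a backtrack at the base point without a case of
    its own.\<close>
  define f where "f i = g (i mod m)" for i
  have f: "(f i, f (Suc i)) \<in> A" for i
  proof -
    have "i mod m < m" using m3 by simp
    then show ?thesis
      using g(1,2) g(3)[of "i mod m"] unfolding f_def by (auto simp: mod_Suc)
  qed
  have per: "f (i + m) = f i" for i by (simp add: f_def)
  have walk: "(f i, f (i + n)) \<in> A ^^ n" for i n
    by (induction n) (use f in \<open>auto intro: relpow_Suc_I\<close>)
  have "f i \<noteq> f (Suc (Suc i))" for i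
  proof
    assume eq: "f i = f (Suc (Suc i))"
    \<comment> \<open>Starting after the backtrack and going on to \<open>f (i + m) = f i\<close>
      takes \<open>m - 2\<close> steps and closes up.\<close>
    have "(f (i + 2), f (i + 2 + (m - 2))) \<in> A ^^ (m - 2)" by (rule walk)
    moreover have "i + 2 + (m - 2) = i + m" using m3 by simp
    then have "f (i + 2 + (m - 2)) = f (i + 2)"
      using per[of i] eq by (simp only: add_2_eq_Suc')
    ultimately have "m \<le> m - 2" using m(1) m3 by (intro min[of _ "f (i + 2)"]) auto
    then show False using m3 by simp
  qed
  then show ?thesis using that m(1) f per by blast
qed

lemma even_labelling_imp_bipartition:
  assumes lab: "arc_labelling A k d" and k: "even k"
  obtains b where "bipartition A b"
proof (cases "A = {}")
  case True
  then show ?thesis using that by (simp add: bipartition_def)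
next
  case False
  have no_odd: "even n" if "(r, r) \<in> A ^^ n" for r n
  proof (rule ccontr)
    assume "odd n"
    with that obtain f m where f: "odd m" "\<And>i. (f i, f (Suc i)) \<in> A" "\<And>i. f (i + m) = f i"
      "\<And>i. f i \<noteq> f (Suc (Suc i))" by (rule odd_closed_walk_nonbacktracking) blast
    have step: "even (d (f (Suc i), f (Suc (Suc i)))) \<longleftrightarrow> odd (d (f i, f (Suc i)))" for i
      using arc_labelling_step[OF lab f(2) f(2) f(4)[symmetric], of i] k by (simp add: dvd_mod_iff)
    have alt: "even (d (f n, f (Suc n))) \<longleftrightarrow> even (d (f 0, f (Suc 0)) + n)" for n
      by (induction n) (auto simp: step)
    \<comment> \<open>After the odd number \<open>m\<close> of steps the first arc returns with the
      opposite parity.\<close>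
    have "f m = f 0" "f (Suc m) = f (Suc 0)" using f(3)[of 0] f(3)[of 1] by simp_all
    then show False using alt[of m] f(1) by simp
  qed
  obtain r where r: "r \<in> Domain A" using False by auto
  \<comment> \<open>The sides are given by parities of walk lengths from \<open>r\<close>; an arc
    within one side would close up to an odd closed walk.\<close>
  define b where "b v \<longleftrightarrow> (\<exists>n. even n \<and> (r, v) \<in> A ^^ n)" for v
  have "b v \<noteq> b w" if vw: "(v, w) \<in> A" for v w
  proof
    assume eq: "b v = b w"
    have "(r, v) \<in> A\<^sup>*" "(r, w) \<in> A\<^sup>*" using conn[OF r] vw sym by blast+
    then obtain n m where nm: "(r, v) \<in> A ^^ n" "(r, w) \<in> A ^^ m"
      by (meson rtrancl_imp_relpow)
    obtain n m where n: "(r, v) \<in> A ^^ n" "(r, w) \<in> A ^^ m" and par: "even (n + m)"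
    proof (cases "b v")
      case True
      then show ?thesis using that eq unfolding b_def by (metis even_add)
    next
      case False
      then have "odd n" "odd m" using nm eq unfolding b_def by auto
      then show ?thesis using that nm by simp
    qed
    have "(r, w) \<in> A ^^ Suc n" using n(1) vw by (rule relpow_Suc_I)
    moreover have "(w, r) \<in> A ^^ m" using n(2) by (rule relpow_sym)
    ultimately have "(r, r) \<in> A ^^ (Suc n + m)" unfolding relpow_add by blast
    then have "even (Suc n + m)" by (rule no_odd)
    then show False using par by simp
  qed
  then have "bipartition A b" by (simp add: bipartition_def)
  then show ?thesis by (rule that)
qed

section \<open>Odd labellings and three colours\<close>

text \<open>For \<open>z \<noteq> u\<close>, passing through \<open>v\<close> in both directions
  gives \<open>d (v, z) = d (u, v) + 1\<close> and \<open>d (v, u) = d (z, v) + 1\<close> modulo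
  \<open>k\<close>. So adjacent edges have equal sums, and connectivity spreads this to all
  edges.\<close>

lemma labelling_reverse_sum:
  assumes lab: "arc_labelling A k d" and uv: "(u, v) \<in> A" and xw: "(x, w) \<in> A"
  shows "(int (d (u, v)) + int (d (v, u))) mod int k = (int (d (x, w)) + int (d (w, x))) mod int k"
proof -
  define q where "q a b = (int (d (a, b)) + int (d (b, a))) mod int k" for a b
  have q_sym: "q a b = q b a" for a b by (simp add: q_def add.commute)
  have q_step: "q v z = q u v" if "(u, v) \<in> A" "(v, z) \<in> A" for u v z
  proof (cases "z = u")
    case False
    have "int (d (v, z)) = (int (d (u, v)) + 1) mod int k"
      using arc_labelling_step[OF lab that False] by (simp add: zmod_int add.commute)
    moreover have "int (d (v, u)) = (int (d (z, v)) + 1) mod int k"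
      using arc_labelling_step[OF lab sym[OF that(2)] sym[OF that(1)]] False by (simp add: zmod_int add.commute)
    ultimately show ?thesis by (simp add: q_def mod_simps algebra_simps)
  qed (simp add: q_sym)
  have "(v, x) \<in> A\<^sup>*" using conn uv xw sym by blast
  then have "\<forall>z. (x, z) \<in> A \<longrightarrow> q x z = q u v"
  proof (induction rule: rtrancl_induct)
    case base
    then show ?case using q_step[OF uv] by simp
  next
    case (step y z)
    have "q z x' = q u v" if "(z, x') \<in> A" for x'
      using q_step[OF step.hyps(2) that] step.IH step.hyps(2) by simp
    then show ?case by blast
  qed
  then show ?thesis using xw by (simp add: q_def)
qed

lemma odd_labelling_imp_3_colouring:
  assumes lab: "arc_labelling A k d" and k: "k > 1" "odd k"
  obtains c :: "'a \<Rightarrow> nat" where "\<And>v. c v < 3" "\<And>v w. (v, w) \<in> A \<Longrightarrow> c v \<noteq> c w"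
proof (cases "A = {}")
  case True
  then show ?thesis using that[of "\<lambda>_. 0"] by simp
next
  case False
  then obtain u0 v0 where a0: "(u0, v0) \<in> A" by auto
  define K where "K = int k"
  have K: "K > 1" "odd K" using k by (simp_all add: K_def)
  define q where "q = int (d (u0, v0)) + int (d (v0, u0))"
  \<comment> \<open>Modulo the odd \<open>K\<close>, \<open>(K + 1) div 2\<close> is the inverse of
    2, so adding \<open>s\<close> to both labels of an edge turns their sum \<open>q\<close> into
    1.\<close>
  define s where "s = (1 - q) * ((K + 1) div 2)"
  have s2: "2 * s = (1 - q) * (K + 1)"
  proof -
    have "2 * ((K + 1) div 2) = K + 1" using K by presburger
    then show ?thesis unfolding s_def by (metis mult.left_commute)
  qed
  define y where "y u v = (int (d (u, v)) + s) mod K" for u v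
  have y_range: "0 \<le> y u v" "y u v < K" for u v using K by (simp_all add: y_def)
  have y_step: "y v w mod K = (y u v + 1) mod K" if "(u, v) \<in> A" "(v, w) \<in> A" "w \<noteq> u" for u v w
  proof -
    have "int (d (v, w)) = (int (d (u, v)) + 1) mod K"
      using arc_labelling_step[OF lab that] by (simp add: K_def zmod_int add.commute)
    then show ?thesis by (simp add: y_def mod_simps algebra_simps)
  qed
  have y_rev: "y v u mod K = (1 - y u v) mod K" if "(u, v) \<in> A" for u v
  proof -
    have "(int (d (u, v)) + int (d (v, u))) mod K = q mod K"
      unfolding K_def q_def by (rule labelling_reverse_sum[OF lab that a0])
    then have "K dvd int (d (u, v)) + int (d (v, u)) - q" by (simp add: mod_eq_dvd_iff)
    moreover have "int (d (v, u)) + s - (1 - (int (d (u, v)) + s)) =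
        (int (d (u, v)) + int (d (v, u)) - q) + K * (1 - q)"
      using s2 by (simp add: algebra_simps)
    ultimately have "K dvd int (d (v, u)) + s - (1 - (int (d (u, v)) + s))"
      by (metis dvd_add dvd_triv_left)
    then show ?thesis by (simp add: y_def mod_simps mod_eq_dvd_iff)
  qed
  \<comment> \<open>Leaving \<open>v\<close> towards \<open>w\<close> adds 1, and reversing that arc
    maps \<open>t\<close> to \<open>1 - t\<close>; together this negates.\<close>
  have y_in: "y w v mod K = (- y u v) mod K" if "(u, v) \<in> A" "(w, v) \<in> A" "u \<noteq> w" for u v w
  proof -
    have "y w v mod K = (1 - y v w) mod K" using y_rev[OF sym[OF that(2)]] .
    also have "\<dots> = (1 - y v w mod K) mod K" by (simp add: mod_simps)
    also have "\<dots> = (1 - (y u v + 1) mod K) mod K" using y_step[OF that(1) sym[OF that(2)]] that(3) by simp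
    also have "\<dots> = (- y u v) mod K" by (simp add: mod_simps)
    finally show ?thesis .
  qed
  \<comment> \<open>By \<open>y_in\<close>, all arcs into \<open>v\<close> give the same
    value.\<close>
  define g where "g v = residue_abs K (y (SOME u. (u, v) \<in> A) v)" for v
  have g: "g v = residue_abs K (y u v)" if "(u, v) \<in> A" for u v
  proof -
    have w: "((SOME u. (u, v) \<in> A), v) \<in> A" using that by (rule someI)
    show ?thesis
    proof (cases "u = (SOME u. (u, v) \<in> A)")
      case False
      then show ?thesis unfolding g_def
        using residue_abs_cong[OF y_in[OF that w False]] residue_abs_minus by simp
    qed (simp add: g_def)
  qed
  \<comment> \<open>These edges lie over the loop: \<open>(K + 1) / 2\<close> is the fixed point of
    \<open>t \<mapsto> 1 - t\<close> modulo \<open>K\<close>, so \<open>g\<close> agrees at both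
    ends.\<close>
  define mid where "mid u v \<longleftrightarrow> (u, v) \<in> A \<and> 2 * y u v = K + 1" for u v
  have mid_parity: "mid u v" if "(u, v) \<in> A" "even (g u) \<longleftrightarrow> even (g v)" for u v
  proof -
    have "g u = residue_abs K (y v u)" by (rule g[OF sym[OF that(1)]])
    also have "\<dots> = residue_abs K (- (y u v - 1))"
      using residue_abs_cong[OF y_rev[OF that(1)]] by simp
    finally have "g u = residue_abs K (y u v - 1)" by (simp only: residue_abs_minus)
    then show ?thesis
      using that g[OF that(1)] residue_abs_pred_parity[OF K y_range, of u v] by (simp add: mid_def)
  qed
  have mid_sym: "mid v u" if "mid u v" for u v
  proof -
    have a: "(u, v) \<in> A" and y: "2 * y u v = K + 1" using that by (simp_all add: mid_def)
    have "y v u = (1 - y u v) mod K" using y_rev[OF a] y_range by simp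
    also have "\<dots> = (1 - y u v + K) mod K" by simp
    also have "\<dots> = 1 - y u v + K" using y K y_range[of u v] by (intro mod_pos_pos_trivial) auto
    finally show ?thesis using a y sym by (simp add: mid_def)
  qed
  have mid_unique: "u = w" if "mid v u" "mid v w" for u v w
  proof (rule ccontr)
    assume neq: "u \<noteq> w"
    \<comment> \<open>Two arcs into \<open>v\<close> have opposite values by \<open>y_in\<close>,
      but two values \<open>(K + 1) / 2\<close> add up to 1 modulo \<open>K\<close>.\<close>
    have m: "mid u v" "mid w v" using that mid_sym by blast+
    then have "y w v mod K = (- y u v) mod K" by (intro y_in) (use neq in \<open>simp_all add: mid_def\<close>)
    then have "K dvd y w v + y u v" by (simp add: mod_eq_dvd_iff)
    moreover have "y w v + y u v = K + 1" using m by (simp add: mid_def)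
    ultimately have "K dvd 1" by (metis dvd_add_triv_left_iff)
    then show False using K by simp
  qed
  \<comment> \<open>An arbitrary numbering of the vertices selects one end of each matching edge for
    the third colour.\<close>
  obtain idx :: "'a \<Rightarrow> nat" where idx: "inj_on idx (Field A)"
    using finite_imp_inj_to_nat_seg[OF finite_Field[OF fin]] by blast
  define top where "top v \<longleftrightarrow> (\<exists>w. mid v w \<and> idx v < idx w)" for v
  define c where "c v = (if top v then 2 else if even (g v) then 0 else 1 :: nat)" for v
  have "c v \<noteq> c w" if vw: "(v, w) \<in> A" for v w
  proof
    assume eq: "c v = c w"
    then have top_eq: "top v = top w" by (auto simp: c_def split: if_splits)
    have False if "mid v w"
    proof -
      have "top v \<longleftrightarrow> idx v < idx w" "top w \<longleftrightarrow> idx w < idx v"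
        using that mid_sym mid_unique unfolding top_def by metis+
      moreover have "idx v \<noteq> idx w"
        using idx vw irrefl unfolding inj_on_def Field_def by (metis DomainI RangeI UnCI)
      ultimately show False using top_eq by linarith
    qed
    moreover have "mid v w"
    proof (cases "top v")
      case False
      then show ?thesis using eq top_eq by (intro mid_parity[OF vw]) (auto simp: c_def split: if_splits)
    next
      case True
      \<comment> \<open>Both vertices lie on matching edges, so \<open>g\<close> agrees at them and
        the arc between them is itself a matching edge.\<close>
      then obtain v' w' where m: "mid v v'" "mid w w'" using top_eq unfolding top_def by blast
      have half: "g x = residue_abs K ((K + 1) div 2)" if "mid x x'" for x x'
      proof -
        have m: "(x', x) \<in> A" "2 * y x' x = K + 1" using mid_sym[OF that] by (simp_all add: mid_def)
        then have "y x' x = (K + 1) div 2" by simp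
        then show ?thesis using g[OF m(1)] by simp
      qed
      then show ?thesis using m by (intro mid_parity[OF vw]) simp
    qed
    ultimately show False by blast
  qed
  moreover have "c v < 3" for v by (simp add: c_def)
  ultimately show ?thesis by (rule that[rotated])
qed

section \<open>Surjective labellings and doubling\<close>

text \<open>For a turn at \<open>v\<close>, two further neighbours \<open>x\<close> and
  \<open>y\<close> give \<open>d (v, u) = d (y, v) + 1 = d (v, x) = d (u, v) + 1\<close> modulo
  \<open>k\<close>.\<close>

lemma labelling_step_branch:
  assumes lab: "arc_labelling A k d" and a: "(u, v) \<in> A" "(v, z) \<in> A"
    and z: "z \<noteq> u \<or> 3 \<le> card (A `` {v})"
  shows "d (v, z) = (d (u, v) + 1) mod k"
proof (cases "z = u")
  case True
  then have "2 \<le> card (A `` {v} - {u})" using z by (auto simp: card_Diff_singleton_if)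
  then obtain T where "T \<subseteq> A `` {v} - {u}" "card T = 2" using obtain_subset_with_card_n by metis
  then obtain x y where xy: "x \<noteq> y" "(v, x) \<in> A" "(v, y) \<in> A" "x \<noteq> u" "y \<noteq> u"
    by (auto simp: card_2_iff)
  have "d (v, u) = (d (y, v) + 1) mod k"
    using arc_labelling_step[OF lab sym[OF xy(3)] sym[OF a(1)]] xy(5) by simp
  also have "\<dots> = d (v, x)"
    using arc_labelling_step[OF lab sym[OF xy(3)] xy(2)] xy(1) by simp
  also have "\<dots> = (d (u, v) + 1) mod k"
    using arc_labelling_step[OF lab a(1) xy(2)] xy(4) by simp
  finally show ?thesis using True by simp
qed (use arc_labelling_step[OF lab a] in simp)

text \<open>Each continuation within \<open>S\<close> raises the label by 1, so all residues are
  met.\<close>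

lemma perpetual_labelling_surj:
  assumes lab: "arc_labelling A k d" and S: "perpetual A S"
  shows "d ` A = {..<k}"
proof (intro equalityI subsetI)
  fix j assume j: "j \<in> {..<k}"
  obtain a where a: "a \<in> S" using S unfolding perpetual_def by auto
  have "S \<subseteq> A" using S unfolding perpetual_def by blast
  have *: "\<exists>e\<in>S. d e = (d a + n) mod k" for n
  proof (induction n)
    case 0
    then show ?case using a arc_labelling_less[OF lab, of a] \<open>S \<subseteq> A\<close> by (intro bexI[of _ a]) auto
  next
    case (Suc n)
    then obtain u v where uv: "(u, v) \<in> S" "d (u, v) = (d a + n) mod k" by auto
    then obtain z where z: "(v, z) \<in> S" "z \<noteq> u \<or> 3 \<le> card (A `` {v})"
      using S unfolding perpetual_def by blast
    have "d (v, z) = (d (u, v) + 1) mod k"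
      using uv z \<open>S \<subseteq> A\<close> by (intro labelling_step_branch[OF lab]) auto
    then have "d (v, z) = (d a + Suc n) mod k" using uv(2) by (simp add: mod_simps)
    then show ?case using z(1) by blast
  qed
  have "d a < k" using a \<open>S \<subseteq> A\<close> by (intro arc_labelling_less[OF lab]) blast
  then have "(d a + (k - d a + j)) mod k = j" using j by simp
  then show "j \<in> d ` A" using *[of "k - d a + j"] \<open>S \<subseteq> A\<close> by force
qed (use arc_labelling_less[OF lab] in auto)

lemma double_labelling:
  assumes lab: "arc_labelling A k d" and k: "odd k" and b: "bipartition A b"
  obtains d' where "arc_labelling A (2 * k) d'"
proof -
  \<comment> \<open>Adding the odd \<open>k\<close> flips the parity and keeps the residue modulo
    \<open>k\<close>; the parity is made to record the side of the tail.\<close>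
  define d' where "d' a = (if even (d a) = b (fst a) then d a else d a + k)" for a
  have mod_k: "d' a mod k = d a mod k" for a by (simp add: d'_def)
  have parity: "even (d' a) = b (fst a)" for a using k by (auto simp: d'_def)
  have less: "d' a < 2 * k" if "a \<in> A" for a
    using arc_labelling_less[OF lab that] by (auto simp: d'_def)
  have "d' (w, z) = (d' (v, w) + 1) mod (2 * k)"
    if vw: "(v, w) \<in> A" "(w, z) \<in> A" "z \<noteq> v" for v w z
  proof -
    have "d' (w, z) mod k = (d' (v, w) + 1) mod k"
      using arc_labelling_step[OF lab vw] mod_k[of "(v, w)"] mod_k[of "(w, z)"]
      by (metis mod_add_left_eq mod_mod_trivial)
    then have "int k dvd int (d' (w, z)) - int (d' (v, w) + 1)"
      by (metis mod_eq_dvd_iff zmod_int)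
    moreover have "even (d' (w, z)) \<noteq> even (d' (v, w))"
      using b vw unfolding parity bipartition_def by auto
    then have "2 dvd int (d' (w, z)) - int (d' (v, w) + 1)" by auto
    moreover have "coprime 2 (int k)" using k by simp
    ultimately have "2 * int k dvd int (d' (w, z)) - int (d' (v, w) + 1)"
      by (intro divides_mult)
    then have "int (d' (w, z)) mod int (2 * k) = int (d' (v, w) + 1) mod int (2 * k)"
      by (simp add: mod_eq_dvd_iff)
    then have "d' (w, z) mod (2 * k) = (d' (v, w) + 1) mod (2 * k)"
      by (metis zmod_int of_nat_eq_iff)
    then show ?thesis using less[OF vw(2)] by simp
  qed
  then have "arc_labelling A (2 * k) d'" using less unfolding arc_labelling_def by blast
  then show ?thesis by (rule that)
qed

text \<open>A shortest path between the two branch vertices does not backtrack; its two orientations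
  together allow walking to and fro with turns at the ends.\<close>

lemma two_branch_perpetual:
  assumes v: "v \<in> Domain A" "3 \<le> card (A `` {v})" and w: "w \<in> Domain A" "3 \<le> card (A `` {w})"
    and "v \<noteq> w"
  obtains S where "perpetual A S"
proof -
  obtain n0 where n0: "(v, w) \<in> A ^^ n0" using conn[OF v(1) w(1)] by (meson rtrancl_imp_relpow)
  define n where "n = (LEAST n. (v, w) \<in> A ^^ n)"
  have n: "(v, w) \<in> A ^^ n" unfolding n_def using n0 by (rule LeastI)
  have min: "n \<le> m" if "(v, w) \<in> A ^^ m" for m unfolding n_def using that by (rule Least_le)
  obtain f where f: "f 0 = v" "f n = w" "\<And>i. i < n \<Longrightarrow> (f i, f (Suc i)) \<in> A"
    using n unfolding relpow_fun_conv by blast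
  have "n \<noteq> 0" using f(1,2) \<open>v \<noteq> w\<close> by metis
  have walk: "i + m \<le> n \<Longrightarrow> (f i, f (i + m)) \<in> A ^^ m" for i m
    by (induction m) (use f(3) in \<open>auto intro: relpow_Suc_I\<close>)
  have nb: "f i \<noteq> f (Suc (Suc i))" if "Suc (Suc i) \<le> n" for i
  proof
    assume eq: "f i = f (Suc (Suc i))"
    \<comment> \<open>Omitting the two steps from \<open>f i\<close> back to itself would give a
      shorter walk.\<close>
    have "(v, f i) \<in> A ^^ i" using walk[of 0 i] f(1) that by simp
    moreover have "(f i, w) \<in> A ^^ (n - i - 2)"
    proof -
      have "i + 2 + (n - i - 2) = n" using that by simp
      then show ?thesis using walk[of "i + 2" "n - i - 2"] f(2) eq
        by (simp only: add_2_eq_Suc' order.refl)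
    qed
    ultimately have "(v, w) \<in> A ^^ (i + (n - i - 2))" unfolding relpow_add by blast
    then show False using min that by fastforce
  qed
  define S where "S = (\<lambda>i. (f i, f (Suc i))) ` {..<n} \<union> (\<lambda>i. (f (Suc i), f i)) ` {..<n}"
  have fwd: "(f i, f (Suc i)) \<in> S" and bwd: "(f (Suc i), f i) \<in> S" if "i < n" for i
    using that by (auto simp: S_def)
  have "\<exists>z. (y, z) \<in> S \<and> (z \<noteq> x \<or> 3 \<le> card (A `` {y}))" if xy: "(x, y) \<in> S" for x y
  proof -
    consider i where "i < n" "x = f i" "y = f (Suc i)" | i where "i < n" "x = f (Suc i)" "y = f i"
      using xy by (auto simp: S_def)
    then show ?thesis
    proof cases
      case 1
      show ?thesis
      proof (cases "Suc i = n")
        case True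
        then show ?thesis using 1 bwd[of i] w f(2) by auto
      next
        case False
        then show ?thesis using 1 fwd[of "Suc i"] nb[of i] by (intro exI[of _ "f (Suc (Suc i))"]) auto
      qed
    next
      case 2
      show ?thesis
      proof (cases i)
        case 0
        then show ?thesis using 2 fwd[of i] v f(1) by auto
      next
        case (Suc j)
        then show ?thesis using 2 bwd[of j] nb[of j] by (intro exI[of _ "f j"]) auto
      qed
    qed
  qed
  moreover have "S \<noteq> {}" using fwd[of 0] \<open>n \<noteq> 0\<close> by auto
  moreover have "S \<subseteq> A" using f(3) sym by (auto simp: S_def)
  ultimately have "perpetual A S" unfolding perpetual_def by blast
  then show ?thesis by (rule that)
qed

section \<open>Labelling a path\<close>

text \<open>With degrees at most 2 the next arc of a walk is determined, if the walk turns around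
  only at leaves. The orbit of the arc out of the leaf \<open>l\<close> covers all arcs, and the
  position on it is the label.\<close>

lemma path_labelling:
  assumes deg: "\<And>v. card (A `` {v}) \<le> 2"
    and leaf: "(l, w) \<in> A" "\<And>z. (l, z) \<in> A \<Longrightarrow> z = w"
    and b: "bipartition A b"
  shows "even (card A)" "\<exists>d. arc_labelling A (card A) d \<and> d ` A = {..<card A}"
proof -
  have deg': "x = y \<or> y = z \<or> x = z" if "(v, x) \<in> A" "(v, y) \<in> A" "(v, z) \<in> A" for v x y z
  proof (rule ccontr)
    assume "\<not> ?thesis"
    then have "card {x, y, z} = 3" by simp
    moreover have "card {x, y, z} \<le> card (A `` {v})"
      using that by (intro card_mono finite_nbs) auto
    ultimately show False using deg[of v] by simp
  qed
  \<comment> \<open>The default \<open>v\<close> makes the walk turn around at a leaf.\<close>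
  define nxt where "nxt v w = (if \<exists>z. (w, z) \<in> A \<and> z \<noteq> v then SOME z. (w, z) \<in> A \<and> z \<noteq> v else v)"
    for v w
  have nxt_eq: "nxt v w = z" if "(v, w) \<in> A" "(w, z) \<in> A" "z \<noteq> v" for v w z
  proof -
    have ex: "\<exists>z. (w, z) \<in> A \<and> z \<noteq> v" using that by blast
    have "(w, nxt v w) \<in> A \<and> nxt v w \<noteq> v"
      using someI_ex[OF ex] ex by (simp add: nxt_def)
    then show ?thesis using deg'[OF sym[OF that(1)] that(2), of "nxt v w"] that(3) by auto
  qed
  have nxt_leaf: "nxt v w = v" if "\<And>z. (w, z) \<in> A \<Longrightarrow> z = v" for v w
    using that by (auto simp: nxt_def)
  have nxt_in: "(w, nxt v w) \<in> A" if "(v, w) \<in> A" for v w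
    using nxt_eq[OF that] nxt_leaf[of w v] sym[OF that] by metis
  \<comment> \<open>This recovers the tail of an arc from the next arc and so makes
    \<open>\<sigma>\<close> injective.\<close>
  have nxt_rev: "nxt (nxt v w) w = v" if "(v, w) \<in> A" for v w
  proof (cases "\<exists>z. (w, z) \<in> A \<and> z \<noteq> v")
    case True
    then obtain z where z: "(w, z) \<in> A" "z \<noteq> v" by blast
    show ?thesis using nxt_eq[OF that z] nxt_eq[OF sym[OF z(1)] sym[OF that]] z(2) by simp
  next
    case False
    then show ?thesis using nxt_leaf by metis
  qed
  define \<sigma> where "\<sigma> a = (snd a, nxt (fst a) (snd a))" for a
  have \<sigma>_in: "\<sigma> a \<in> A" if "a \<in> A" for a
    using nxt_in that by (simp add: \<sigma>_def)
  have \<sigma>_inj: "inj_on \<sigma> A"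
  proof (rule inj_onI)
    fix a c assume ac: "a \<in> A" "c \<in> A" "\<sigma> a = \<sigma> c"
    from ac(3) have "snd a = snd c \<and> nxt (fst a) (snd a) = nxt (fst c) (snd c)"
      unfolding \<sigma>_def prod.inject .
    then have "nxt (nxt (fst a) (snd a)) (snd a) = nxt (nxt (fst c) (snd c)) (snd c)"
      by metis
    then have "fst a = fst c" using nxt_rev ac(1,2) by simp
    then show "a = c" using ac(3) by (simp add: \<sigma>_def prod_eq_iff)
  qed
  define o' where "o' i = (\<sigma> ^^ i) (l, w)" for i
  have o0: "o' 0 = (l, w)" and oS: "o' (Suc i) = \<sigma> (o' i)" for i by (simp_all add: o'_def)
  have o_in: "o' i \<in> A" for i by (induction i) (simp_all add: o0 oS leaf(1) \<sigma>_in)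
  have cancel: "o' (i + m) = o' (j + m) \<Longrightarrow> o' i = o' j" for i j m
    by (induction m) (use \<sigma>_inj o_in in \<open>auto simp: oS inj_on_def\<close>)
  \<comment> \<open>Finiteness forces a repetition, and injectivity of \<open>\<sigma>\<close> moves
    it back to the start, so the orbit is periodic.\<close>
  have "\<not> inj_on o' UNIV"
    using fin o_in finite_subset[of "range o'" A] finite_imageD[of o' UNIV] by auto
  then obtain i j where "o' i = o' j" "i < j" unfolding inj_on_def by (metis nat_neq_iff)
  then have "o' (j - i) = o' 0" using cancel[of "j - i" i 0] by simp
  then have ex: "\<exists>N>0. o' N = o' 0" using \<open>i < j\<close> by (intro exI[of _ "j - i"]) simp
  define N where "N = (LEAST N. N > 0 \<and> o' N = o' 0)"
  have N: "N > 0" "o' N = o' 0" using LeastI_ex[OF ex] unfolding N_def by auto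
  have N_min: "N \<le> m" if "m > 0" "o' m = o' 0" for m
    unfolding N_def by (rule Least_le) (use that in blast)
  have o_add: "o' (i + N) = o' i" for i by (induction i) (use N in \<open>simp_all add: oS\<close>)
  have o_mod: "o' (i mod N) = o' i" for i
  proof -
    have "o' (i mod N + m * N) = o' (i mod N)" for m
    proof (induction m)
      case (Suc m)
      have "i mod N + Suc m * N = (i mod N + m * N) + N" by simp
      then show ?case using Suc o_add by metis
    qed simp
    from this[of "i div N"] show ?thesis by (simp add: mod_div_mult_eq)
  qed
  have o_inj: "inj_on o' {..<N}"
  proof (rule linorder_inj_onI)
    fix i j assume ij: "i < j" "i \<in> {..<N}" "j \<in> {..<N}"
    show "o' i \<noteq> o' j"
    proof
      assume "o' i = o' j"
      then have "o' (j - i) = o' 0" using cancel[of "j - i" i 0] ij by simp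
      then show False using N_min[of "j - i"] ij by simp
    qed
  qed auto
  have o_pre: "\<exists>j. \<sigma> (o' j) = o' i" for i
  proof (cases i)
    case 0
    obtain m where "N = Suc m" using N(1) gr0_implies_Suc by blast
    then have "\<sigma> (o' m) = o' i" using N(2) 0 by (simp flip: oS)
    then show ?thesis by blast
  next
    case (Suc m)
    then show ?thesis by (auto simp: oS)
  qed
  text \<open>The walk turns around at the leaf, so the orbit of \<open>\<sigma>\<close> is closed under reversal.\<close>
  have o_rev: "\<exists>j. o' j = prod.swap (o' i)" for i
  proof (induction i)
    case 0
    obtain j where j: "\<sigma> (o' j) = o' 0" using o_pre by blast
    have "nxt w l = w" by (rule nxt_leaf) (rule leaf(2))
    then have "\<sigma> (w, l) = \<sigma> (o' j)" unfolding j by (simp add: \<sigma>_def o0)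
    then have "o' j = (w, l)" using \<sigma>_inj o_in[of j] sym[OF leaf(1)] by (simp add: inj_on_eq_iff)
    then show ?case by (auto simp: o0)
  next
    case (Suc i)
    obtain x y where xy: "o' i = (x, y)" by fastforce
    then have A: "(x, y) \<in> A" using o_in[of i] by simp
    obtain m where m: "o' m = prod.swap (o' i)" using Suc by blast
    obtain j where j: "\<sigma> (o' j) = o' m" using o_pre by blast
    have rev: "prod.swap (o' (Suc i)) = (nxt x y, y)" by (simp add: oS xy \<sigma>_def)
    have "\<sigma> (nxt x y, y) = \<sigma> (o' j)"
      unfolding j m using nxt_rev[OF A] by (simp add: xy \<sigma>_def)
    moreover have "(nxt x y, y) \<in> A" using nxt_in[OF A] by (rule sym)
    ultimately have "o' j = (nxt x y, y)" using \<sigma>_inj o_in[of j] by (simp add: inj_on_eq_iff)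
    then show ?case unfolding rev by blast
  qed
  \<comment> \<open>The only arcs out of \<open>v\<close> are the reversed arc and the image under
    \<open>\<sigma>\<close>; both are on the orbit.\<close>
  have o_step: "\<exists>j. o' j = (v, z)" if i: "o' i = (u, v)" and vz: "(v, z) \<in> A" for i u v z
  proof (cases "z = u")
    case True
    then show ?thesis using o_rev[of i] i by simp
  next
    case False
    have "o' (Suc i) = (v, z)"
      using nxt_eq[OF _ vz False] o_in[of i] i by (simp add: oS \<sigma>_def)
    then show ?thesis by blast
  qed
  have o_all: "\<exists>i. o' i = (u, v)" if "(u, v) \<in> A" for u v
  proof -
    have "(l, u) \<in> A\<^sup>*" using conn leaf(1) that by blast
    then have "\<forall>z. (u, z) \<in> A \<longrightarrow> (\<exists>i. o' i = (u, z))"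
    proof (induction rule: rtrancl_induct)
      case base
      then show ?case using leaf(2) o0 by blast
    next
      case (step y z)
      then show ?case using o_step by blast
    qed
    then show ?thesis using that by blast
  qed
  have img: "o' ` {..<N} = A"
  proof (intro equalityI subsetI)
    fix a assume "a \<in> A"
    then obtain i where "a = o' i" using o_all[of "fst a" "snd a"] by auto
    then have "a = o' (i mod N)" by (simp only: o_mod)
    then show "a \<in> o' ` {..<N}" using N(1) by (intro image_eqI[of _ _ "i mod N"]) simp_all
  qed (use o_in in auto)
  have card: "card A = N" using card_image[OF o_inj] img by simp
  \<comment> \<open>Tails alternate between the sides, so returning to the first arc takes an even
    number of steps.\<close>
  have "b (fst (o' i)) = (b l = even i)" for i
  proof (induction i)
    case (Suc i)
    have "(fst (o' i), fst (o' (Suc i))) \<in> A" using o_in[of i] by (simp add: oS \<sigma>_def)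
    then have "b (fst (o' i)) \<noteq> b (fst (o' (Suc i)))" using b unfolding bipartition_def by blast
    then show ?case using Suc by auto
  qed (simp add: o0)
  from this[of N] show "even (card A)" using N(2) card by (auto simp: o0)
  define d where "d = the_inv_into {..<N} o'"
  have d_o: "d (o' i) = i mod N" for i
    using the_inv_into_f_f[OF o_inj, of "i mod N"] N(1) o_mod[of i] by (simp add: d_def)
  have "d a < N" if a: "a \<in> A" for a
  proof -
    obtain i where "a = o' i" using a img by blast
    then show ?thesis using d_o[of i] N(1) by simp
  qed
  moreover have "d (y, z) = (d (x, y) + 1) mod N" if xyz: "(x, y) \<in> A" "(y, z) \<in> A" "z \<noteq> x" for x y z
  proof -
    obtain i where i: "o' i = (x, y)" using o_all[OF xyz(1)] by blast
    then have "o' (Suc i) = (y, z)" using nxt_eq[OF xyz] by (simp add: oS \<sigma>_def)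
    then show ?thesis using d_o[of i] d_o[of "Suc i"] i by (simp add: mod_simps)
  qed
  moreover have "d ` A = {..<N}"
    unfolding d_def using the_inv_into_onto[OF o_inj] img by simp
  ultimately show "\<exists>d. arc_labelling A (card A) d \<and> d ` A = {..<card A}"
    unfolding card arc_labelling_def by blast
qed

end

section \<open>From directed graphs to arc relations\<close>

lemma pcas_awalk_verts: "pcas u p v \<Longrightarrow> pawalk_verts u p = u # map snd p"
  by (induction p arbitrary: u) auto

lemma pcas_fst_nth: "pcas u p v \<Longrightarrow> i < length p \<Longrightarrow> fst (p ! i) = (u # map snd p) ! i"
  by (induction p arbitrary: u i) (auto simp: nth_Cons split: nat.splits)

lemma pcas_last: "pcas u p v \<Longrightarrow> p \<noteq> [] \<Longrightarrow> snd (last p) = v"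
  by (induction p arbitrary: u) auto

text \<open>The heads on a cycle are distinct, and for length at least 3 the predecessor and
  successor of an arc differ, so the walk never turns around.\<close>

lemma cycle_perpetual:
  assumes "pre_digraph.cycle (with_proj G) p" "3 \<le> length p"
  shows "perpetual (parcs G) (set p)"
proof -
  obtain u where p: "set p \<subseteq> parcs G" "pcas u p u" and dist: "distinct (map snd p)"
    using assms(1) unfolding pre_digraph.cycle_def pre_digraph.awalk_def
    by (auto simp: cas_with_proj_eq awalk_verts_with_proj_eq pcas_awalk_verts)
  define n where "n = length p"
  have n3: "3 \<le> n" using assms(2) by (simp add: n_def)
  have ne: "p \<noteq> []" using assms(2) by auto
  have snd_inj: "i = j" if "snd (p ! i) = snd (p ! j)" "i < n" "j < n" for i j
    using dist that by (auto simp: n_def distinct_conv_nth)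
  have last: "snd (p ! (n - 1)) = u"
    using pcas_last[OF p(2) ne] ne by (simp add: n_def last_conv_nth)
  have fst0: "fst (p ! 0) = snd (p ! (n - 1))"
    using pcas_fst_nth[OF p(2), of 0] ne last by simp
  have fstS: "fst (p ! Suc i) = snd (p ! i)" if "Suc i < n" for i
    using pcas_fst_nth[OF p(2), of "Suc i"] that by (simp add: n_def)
  have "\<exists>z. (y, z) \<in> set p \<and> (z \<noteq> x \<or> 3 \<le> card (parcs G `` {y}))" if xy: "(x, y) \<in> set p" for x y
  proof -
    obtain i where i: "i < n" "p ! i = (x, y)" using xy by (auto simp: in_set_conv_nth n_def)
    \<comment> \<open>\<open>r\<close> and \<open>s\<close> are the cyclically previous and next
      positions; the head of \<open>p ! r\<close> is the tail \<open>x\<close>.\<close>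
    define r where "r = (if i = 0 then n - 1 else i - 1)"
    define s where "s = (if Suc i = n then 0 else Suc i)"
    have rs: "r < n" "s < n" "r \<noteq> s" using i n3 by (auto simp: r_def s_def)
    have "x = snd (p ! r)" using i fst0 fstS[of "i - 1"] by (auto simp: r_def)
    moreover have "y = fst (p ! s)" using i fst0 fstS[of i] by (auto simp: s_def)
    moreover have "p ! s \<in> set p" using rs(2) by (simp add: n_def)
    ultimately show ?thesis
      using snd_inj[of s r] rs by (intro exI[of _ "snd (p ! s)"]) auto
  qed
  then show ?thesis unfolding perpetual_def using p(1) n3 by (auto simp: n_def)
qed

lemma pair_graph_symmetric_arcs:
  assumes "pair_graph G" "Digraph_Component.connected (with_proj G)"
  shows "symmetric_arcs (parcs G)"
proof -
  interpret pair_graph G by fact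
  show ?thesis
  proof
    show "finite (parcs G)" by (rule pair_finite_arcs)
    show "(v, u) \<in> parcs G" if "(u, v) \<in> parcs G" for u v
      using pair_sym_arcs that by (auto simp: symmetric_def dest: symD)
    show "(u, u) \<notin> parcs G" for u using pair_no_loops by fastforce
    have sc: "strongly_connected (with_proj G)"
      using symmetric_connected_imp_strongly_connected[OF pair_sym_arcs assms(2)] .
    show "(u, v) \<in> (parcs G)\<^sup>*" if "u \<in> Domain (parcs G)" "v \<in> Domain (parcs G)" for u v
    proof -
      have "u \<in> pverts G" "v \<in> pverts G" using that in_arcsD1 by auto
      then have "u \<rightarrow>\<^sup>*\<^bsub>with_proj G\<^esub> v" using sc by (auto simp: strongly_connected_def)
      then show ?thesis using reachable_rtranclI by fastforce
    qed
  qed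
qed

section \<open>The chromatic number\<close>

lemma chromatic_number_le: "proper_colouring G n c \<Longrightarrow> chromatic_number G \<le> n"
  unfolding chromatic_number_def by (rule Least_le) blast

text \<open>Numbering the finitely many vertices injectively is a proper colouring, so the least
  number is attained.\<close>

lemma chromatic_number_colouring:
  assumes "pair_graph G"
  obtains c where "proper_colouring G (chromatic_number G) c"
proof -
  interpret pair_graph G by fact
  obtain c :: "'a \<Rightarrow> nat" and n where c: "c ` pverts G = {i. i < n}" "inj_on c (pverts G)"
    using finite_imp_inj_to_nat_seg[OF pair_finite_verts] by blast
  have "proper_colouring G n c"
    unfolding proper_colouring_def
  proof (intro conjI ballI allI impI)
    fix v w assume vw: "(v, w) \<in> parcs G"
    then have "v \<noteq> w" using pair_no_loops by fastforce
    then show "c v \<noteq> c w" using c(2) in_arcsD1[OF vw] in_arcsD2[OF vw] by (simp add: inj_on_eq_iff)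
  qed (use c(1) in auto)
  then have "\<exists>n c. proper_colouring G n c" by blast
  then have "\<exists>c. proper_colouring G (chromatic_number G) c"
    unfolding chromatic_number_def by (rule LeastI_ex)
  then show ?thesis using that by blast
qed

lemma chromatic_number_ge_2:
  assumes "pair_graph G" "parcs G \<noteq> {}"
  shows "2 \<le> chromatic_number G"
proof -
  interpret pair_graph G by fact
  obtain c where c: "proper_colouring G (chromatic_number G) c"
    using chromatic_number_colouring assms(1) by blast
  obtain v w where vw: "(v, w) \<in> parcs G" using assms(2) by auto
  then have "c v < chromatic_number G" "c w < chromatic_number G" "c v \<noteq> c w"
    using c in_arcsD1[OF vw] in_arcsD2[OF vw] unfolding proper_colouring_def by blast+
  then show ?thesis by linarith
qed

lemma chromatic_number_eq_2_iff:
  assumes "pair_graph G"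
  shows "chromatic_number G = 2 \<longleftrightarrow> parcs G \<noteq> {} \<and> (\<exists>b. bipartition (parcs G) b)"
proof (intro iffI conjI)
  assume two: "chromatic_number G = 2"
  show "parcs G \<noteq> {}"
  proof
    assume "parcs G = {}"
    then have "proper_colouring G 1 (\<lambda>_. 0)" by (simp add: proper_colouring_def)
    then show False using chromatic_number_le two by fastforce
  qed
  interpret pair_graph G by fact
  obtain c where c: "proper_colouring G 2 c" using chromatic_number_colouring[OF assms] two by metis
  have "(c v = 0) \<noteq> (c w = 0)" if vw: "(v, w) \<in> parcs G" for v w
  proof -
    have "c v < 2" "c w < 2" "c v \<noteq> c w"
      using c vw in_arcsD1[OF vw] in_arcsD2[OF vw] unfolding proper_colouring_def by blast+
    then show ?thesis by linarith
  qed
  then have "bipartition (parcs G) (\<lambda>v. c v = 0)" unfolding bipartition_def by blast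
  then show "\<exists>b. bipartition (parcs G) b" by blast
next
  assume *: "parcs G \<noteq> {} \<and> (\<exists>b. bipartition (parcs G) b)"
  then obtain b where b: "bipartition (parcs G) b" by blast
  have "proper_colouring G 2 (\<lambda>v. if b v then 0 else 1)"
    using b unfolding proper_colouring_def bipartition_def by auto
  then show "chromatic_number G = 2"
    using chromatic_number_le[of G 2] chromatic_number_ge_2[OF assms] * by (simp add: le_antisym)
qed

section \<open>Graphs without perpetual arc sets, and the conclusion\<close>

text \<open>A cycle or two branch vertices would give a perpetual set. So the graph is a tree with
  at most one branch vertex, and not being an extended star leaves none.\<close>

lemma no_perpetual_imp_path:
  assumes G: "pair_graph G" "Digraph_Component.connected (with_proj G)" "\<not> extended_star G"
    and ne: "parcs G \<noteq> {}" and np: "\<And>S. \<not> perpetual (parcs G) S"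
  shows "card (parcs G `` {v}) \<le> 2" "\<exists>l w. (l, w) \<in> parcs G \<and> (\<forall>z. (l, z) \<in> parcs G \<longrightarrow> z = w)"
proof -
  interpret pair_graph G by fact
  interpret A: symmetric_arcs "parcs G" using pair_graph_symmetric_arcs[OF G(1,2)] .
  have deg: "out_degree (with_proj G) v = card (parcs G `` {v})" for v
  proof -
    have "out_arcs (with_proj G) v = Pair v ` (parcs G `` {v})" by (auto simp: out_arcs_def)
    then show ?thesis by (simp add: out_degree_def card_image inj_on_def)
  qed
  have dom: "v \<in> Domain (parcs G)" if "3 \<le> card (parcs G `` {v})" for v
  proof (rule ccontr)
    assume "v \<notin> Domain (parcs G)"
    then have "parcs G `` {v} = {}" by blast
    then show False using that by simp
  qed
  have "undirected_tree G"
    unfolding undirected_tree_def using G(2) np cycle_perpetual by blast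
  then have no_unique: "\<not> (\<exists>!v. v \<in> pverts G \<and> 3 \<le> card (parcs G `` {v}))"
    using G(3) unfolding extended_star_def deg by blast
  have uniq: "v = w" if "3 \<le> card (parcs G `` {v})" "3 \<le> card (parcs G `` {w})" for v w
    using A.two_branch_perpetual[OF dom[OF that(1)] that(1) dom[OF that(2)] that(2)] np by blast
  show "card (parcs G `` {v}) \<le> 2"
  proof (rule ccontr)
    assume "\<not> ?thesis"
    then have v: "3 \<le> card (parcs G `` {v})" by simp
    then have "v \<in> pverts G" using dom in_arcsD1 by blast
    then show False using no_unique v uniq by blast
  qed
  \<comment> \<open>If every arc had a continuation, the set of all arcs would be perpetual; an arc
    without one ends in a leaf.\<close>
  obtain u v where uv: "(u, v) \<in> parcs G" "\<And>z. (v, z) \<in> parcs G \<Longrightarrow> z = u"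
    using np[of "parcs G"] ne unfolding perpetual_def by blast
  then show "\<exists>l w. (l, w) \<in> parcs G \<and> (\<forall>z. (l, z) \<in> parcs G \<longrightarrow> z = w)"
    using A.sym by blast
qed

theorem theorem3p5:
  fixes G :: "'a pair_pre_digraph"
  assumes "pair_graph G"
    and "Digraph_Component.connected (with_proj G)"
    and "\<not> extended_star G"
  shows "(even (oriented_edge_periodic_colouring_number G) \<longleftrightarrow> chromatic_number G = 2) \<and>
         (oriented_edge_periodic_colouring_number G > 1 \<and>
            odd (oriented_edge_periodic_colouring_number G) \<longrightarrow> chromatic_number G = 3)"
proof -
  interpret symmetric_arcs "parcs G" using pair_graph_symmetric_arcs assms(1,2) .
  define k where "k = oriented_edge_periodic_colouring_number G"
  show ?thesis
  proof (cases "parcs G = {}")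
    case True
    \<comment> \<open>Without edges the number takes its default value 1, which is odd, and the
      chromatic number is not 2.\<close>
    then have "\<not> circularly_partite G j" for j
      using circularly_partite_le_card[OF fin, of j] by (auto simp: circularly_partite_iff_labelling)
    then have "k = 1" by (simp add: k_def oriented_edge_periodic_colouring_number_def)
    then show ?thesis using True chromatic_number_eq_2_iff[OF assms(1)] by (simp add: k_def)
  next
    case False
    have max: "j \<le> k" if "circularly_partite G j" for j
      unfolding k_def using oriented_edge_periodic_colouring_number_greatest(2)[OF fin False that] .
    have circ: "circularly_partite G k"
      unfolding k_def using oriented_edge_periodic_colouring_number_greatest(1)[OF fin False] .
    then obtain d where "1 \<le> k" and d: "arc_labelling (parcs G) k d"
      unfolding circularly_partite_iff_labelling by blast
    have "even k" if two: "chromatic_number G = 2"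
    proof (rule ccontr)
      \<comment> \<open>Either doubling contradicts the maximality of \<open>k\<close>, or
        \<open>G\<close> is a path and \<open>k\<close> is its even number of arcs.\<close>
      assume odd: "odd k"
      obtain b where b: "bipartition (parcs G) b"
        using two chromatic_number_eq_2_iff[OF assms(1)] by blast
      show False
      proof (cases "\<exists>S. perpetual (parcs G) S")
        case True
        then obtain S where S: "perpetual (parcs G) S" by blast
        obtain d' where d': "arc_labelling (parcs G) (2 * k) d'"
          using double_labelling[OF d odd b] .
        then have "circularly_partite G (2 * k)"
          using perpetual_labelling_surj[OF d' S] \<open>1 \<le> k\<close>
          unfolding circularly_partite_iff_labelling by auto
        then show False using max[of "2 * k"] \<open>1 \<le> k\<close> by simp
      next
        case np: False
        obtain l w where lw: "(l, w) \<in> parcs G" "\<And>z. (l, z) \<in> parcs G \<Longrightarrow> z = w"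
          using no_perpetual_imp_path(2)[OF assms False] np by blast
        have deg: "card (parcs G `` {v}) \<le> 2" for v
          using no_perpetual_imp_path(1)[OF assms False] np by blast
        have "circularly_partite G (card (parcs G))"
          using path_labelling(2)[OF deg lw b] False fin
          unfolding circularly_partite_iff_labelling by (simp add: Suc_le_eq card_gt_0_iff)
        then have "k = card (parcs G)"
          using max circularly_partite_le_card[OF fin circ] by (simp add: le_antisym)
        then show False using path_labelling(1)[OF deg lw b] odd by simp
      qed
    qed
    moreover have "chromatic_number G = 2" if "even k"
      using even_labelling_imp_bipartition[OF d that] False chromatic_number_eq_2_iff[OF assms(1)]
      by blast
    \<comment> \<open>The value 2 may be excluded here, because it would make \<open>k\<close>
      even.\<close>
    moreover have "chromatic_number G = 3" if k: "k > 1" "odd k" and ne2: "chromatic_number G \<noteq> 2"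
    proof -
      obtain c :: "'a \<Rightarrow> nat" where "\<And>v. c v < 3" "\<And>v w. (v, w) \<in> parcs G \<Longrightarrow> c v \<noteq> c w"
        using odd_labelling_imp_3_colouring[OF d k] by blast
      then have "proper_colouring G 3 c" unfolding proper_colouring_def by blast
      then have "chromatic_number G \<le> 3" by (rule chromatic_number_le)
      then show ?thesis using chromatic_number_ge_2[OF assms(1) False] ne2 by linarith
    qed
    ultimately show ?thesis unfolding k_def by blast
  qed
qed

end
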